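(* Let $S,n_h,M,d_h\ge 1$ be integers. For $1\le s\le S$, $1\le r\le n_h$ let $\mathbf Z_{s,r}\in\mathbb R^{M\times d_h}$, let $\mathbf A_{s,r}\in\mathbb R^{M\times M}$ be row-stochastic (nonnegative entries, each row summing to one), let $\mathbf W_{v,r}\in\mathbb R^{d_h\times d_h}$, and set $\mathbf Z=(\mathbf Z_{s,r})$ and $\Delta\mathbf Z=(\mathbf A_{s,r}\mathbf Z_{s,r}\mathbf W_{v,r})$. Let $\langle\cdot,\cdot\rangle_{\mathcal D}$, $\|\cdot\|_{\mathcal D}$ and the centering projection $\mathbf\Pi$ be as defined in the context. Suppose that for some $q$ with $0\le q<1$, \[ s_Z:=\|\mathbf\Pi\mathbf Z\|_{\mathcal D}>0,\qquad \|\mathbf\Pi\Delta\mathbf Z\|_{\mathcal D}\le q\,s_Z . \] Let $\mathbf E$ be a tuple of the same shape as $\mathbf Z$, let $\mathbf T=\mathbf Z+\mathbf E$, and suppose \[ 0<e:=\|\mathbf E\|_{\mathcal D}<\tfrac12(1-q)s_Z,\qquad \Delta\mathbf Z\neq 0,\qquad |\langle\mathbf E,\Delta\mathbf Z\rangle_{\mathcal D}|\ge\alpha\, e\,\|\Delta\mathbf Z\|_{\mathcal D} \] for some $\alpha$ with $0<\alpha\le1$. Define $\gamma_*=\langle\mathbf E,\Delta\mathbf Z\rangle_{\mathcal D}/\|\Delta\mathbf Z\|_{\mathcal D}^2$ and let $\gamma=\theta\gamma_*$ with $0<\theta\le1$. Put \[ \mathcal L_{\mathrm{no}}=\|\mathbf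 Z-\mathbf T\|_{\mathcal D}^2,\qquad \mathcal L_{\mathrm{van}}=\|\Delta\mathbf Z-\mathbf T\|_{\mathcal D}^2,\qquad \mathcal L_{\mathrm{SRPA}}=\|\mathbf Z+\gamma\Delta\mathbf Z-\mathbf T\|_{\mathcal D}^2 . \] Then \[ \mathcal L_{\mathrm{SRPA}}\le[1-\theta(2-\theta)\alpha^2]e^2<\mathcal L_{\mathrm{no}}=e^2<\mathcal L_{\mathrm{van}}, \] \[ \|\gamma\Delta\mathbf Z\|_{\mathcal D}\le\theta e, \] \[ \|\mathbf\Pi(\mathbf Z+\gamma\Delta\mathbf Z)\|_{\mathcal D}\ge s_Z-\theta e>q s_Z\ge\|\mathbf\Pi\Delta\mathbf Z\|_{\mathcal D}. \]
   Context: For tuples $\mathbf X=(\mathbf X_{s,r})$, $\mathbf Y=(\mathbf Y_{s,r})$ of real $M\times d_h$ matrices ($1\le s\le S$ indexes inputs, $1\le r\le n_h$ indexes attention heads), the cohort inner product is $\langle\mathbf X,\mathbf Y\rangle_{\mathcal D}=S^{-1}\sum_{s=1}^S\sum_{r=1}^{n_h}\langle\mathbf X_{s,r},\mathbf Y_{s,r}\rangle_F$, where $\langle\cdot,\cdot\rangle_F$ is the Frobenius inner product, and $\|\cdot\|_{\mathcal D}$ is the induced norm. The centering projection $\mathbf\Pi=\mathbf I_M-M^{-1}\mathbf 1_M\mathbf 1_M^\top$ acts on each component by left multiplication: $(\mathbf\Pi\mathbf X)_{s,r}=\mathbf\Pi\mathbf X_{s,r}$. The matrices $\mathbf A_{s,r}$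 are fixed given matrices (attention matrices already evaluated at the given inputs). The single real scalar $\gamma$ is shared across all $s$ and $r$. *)

theory Defs
  imports "HOL-Analysis.Analysis"
begin

text \<open>
  Inputs, heads, matrix rows (tokens) and matrix columns (head coordinates) are indexed by the
  finite types \<open>'s\<close>, \<open>'h\<close>, \<open>'m\<close>, \<open>'d\<close>; thus \<open>S = CARD('s)\<close>, \<open>n_h = CARD('h)\<close>, \<open>M = CARD('m)\<close>,
  \<open>d_h = CARD('d)\<close>, all automatically at least 1.  A tuple is a vector of vectors of matrices, so
  sum, difference, zero and real multiples of tuples are the componentwise library operations.
\<close>

type_synonym ('s, 'h, 'm, 'd) cohort = "real ^ 'd ^ 'm ^ 'h ^ 's"

text \<open>
  On \<open>real ^ 'd ^ 'm\<close> the library inner product is the Frobenius inner product, the sum over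
  \<open>i, j\<close> of \<open>A $ i $ j * B $ i $ j\<close>.  The library inner product and norm on tuples lack the
  factor \<open>1 / S\<close>, hence the separate definitions.
\<close>

definition cohort_inner ::
  "('s::finite, 'h::finite, 'm::finite, 'd::finite) cohort \<Rightarrow> ('s, 'h, 'm, 'd) cohort \<Rightarrow> real" where
  "cohort_inner X Y =
     (1 / real CARD('s)) * (\<Sum>s\<in>UNIV. \<Sum>r\<in>UNIV. (X $ s $ r) \<bullet> (Y $ s $ r))"

definition cohort_norm ::
  "('s::finite, 'h::finite, 'm::finite, 'd::finite) cohort \<Rightarrow> real" where
  "cohort_norm X = sqrt (cohort_inner X X)"

definition centering_matrix :: "real ^ 'm ^ 'm::finite" where
  "centering_matrix = mat 1 - (1 / real CARD('m)) *\<^sub>R (\<chi> i j. 1)"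

definition centering ::
  "('s::finite, 'h::finite, 'm::finite, 'd::finite) cohort \<Rightarrow> ('s, 'h, 'm, 'd) cohort" where
  "centering X = (\<chi> s r. centering_matrix ** (X $ s $ r))"

definition row_stochastic :: "real ^ 'm ^ 'm::finite \<Rightarrow> bool" where
  "row_stochastic A \<longleftrightarrow> (\<forall>i j. 0 \<le> A $ i $ j) \<and> (\<forall>i. (\<Sum>j\<in>UNIV. A $ i $ j) = 1)"

definition attention_update ::
  "real ^ 'm ^ 'm ^ 'h ^ 's \<Rightarrow> real ^ 'd ^ 'd ^ 'h \<Rightarrow> ('s::finite, 'h::finite, 'm::finite, 'd::finite) cohort
     \<Rightarrow> ('s, 'h, 'm, 'd) cohort" where
  "attention_update A W Z = (\<chi> s r. (A $ s $ r) ** (Z $ s $ r) ** (W $ r))"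

end

theory Submission
  imports Defs
begin

text \<open>
  The scalar \<open>\<gamma>_star\<close> minimises \<open>\<gamma> \<mapsto> \<parallel>\<gamma> \<Delta>Z - E\<parallel>\<^sup>2\<close>, and the relaxed step \<open>\<theta> \<gamma>_star\<close> lowers this
  quadratic from \<open>e\<^sup>2\<close> by \<open>\<theta> (2 - \<theta>) \<langle>E, \<Delta>Z\<rangle>\<^sup>2 / \<parallel>\<Delta>Z\<parallel>\<^sup>2\<close>, while Cauchy--Schwarz bounds the step length
  by \<open>\<theta> e\<close>.  The centering projection is linear and nonexpansive, so
  \<open>\<parallel>\<Delta>Z - Z - E\<parallel> \<ge> \<parallel>\<Pi>Z\<parallel> - \<parallel>\<Pi>\<Delta>Z\<parallel> - e \<ge> (1 - q) s_Z - e > e\<close>, and a step of length at most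
  \<open>\<theta> e\<close> lowers \<open>\<parallel>\<Pi>Z\<parallel>\<close> by at most \<open>\<theta> e\<close>.
\<close>

text \<open>Reduces everything to the library inner product up to the constant factor
  \<open>1 / S\<close>, so that the usual Euclidean facts transfer by rescaling.\<close>

lemma cohort_inner_eq:
  fixes X Y :: "('s::finite, 'h::finite, 'm::finite, 'd::finite) cohort"
  shows "cohort_inner X Y = (X \<bullet> Y) / real CARD('s)"
  by (simp add: cohort_inner_def inner_vec_def)

lemma cohort_norm_eq:
  fixes X :: "('s::finite, 'h::finite, 'm::finite, 'd::finite) cohort"
  shows "cohort_norm X = norm X / sqrt (real CARD('s))"
  by (simp add: cohort_norm_def cohort_inner_eq norm_eq_sqrt_inner real_sqrt_divide)

lemma cohort_norm_pos: "X \<noteq> 0 \<Longrightarrow> 0 < cohort_norm X"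
  by (simp add: cohort_norm_eq)

lemma cohort_norm_scaleR: "cohort_norm (c *\<^sub>R X) = \<bar>c\<bar> * cohort_norm X"
  by (simp add: cohort_norm_eq)

lemma cohort_norm_triangle: "cohort_norm (X + Y) \<le> cohort_norm X + cohort_norm Y"
  unfolding cohort_norm_eq
  by (metis add_divide_distrib divide_right_mono norm_triangle_ineq of_nat_0_le_iff real_sqrt_ge_zero)

lemma cohort_norm_minus: "cohort_norm (- X) = cohort_norm X"
  by (simp add: cohort_norm_eq)

lemma cohort_norm_square_diff:
  "(cohort_norm (c *\<^sub>R X - Y))\<^sup>2
     = (cohort_norm Y)\<^sup>2 - 2 * c * cohort_inner Y X + c\<^sup>2 * (cohort_norm X)\<^sup>2"
proof -
  have "(norm (c *\<^sub>R X - Y))\<^sup>2 = (norm Y)\<^sup>2 - 2 * c * (Y \<bullet> X) + c\<^sup>2 * (norm X)\<^sup>2"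
    unfolding power2_norm_eq_inner
    by (simp add: inner_diff_left inner_diff_right inner_commute power2_eq_square)
  then show ?thesis
    by (simp add: cohort_norm_eq cohort_inner_eq power_divide add_divide_distrib diff_divide_distrib)
qed

lemma cohort_Cauchy_Schwarz: "\<bar>cohort_inner X Y\<bar> \<le> cohort_norm X * cohort_norm Y"
  by (simp add: cohort_norm_eq cohort_inner_eq divide_right_mono Cauchy_Schwarz_ineq2)

text \<open>Exhibits the projection as mean subtraction in each column, so that its nonexpansiveness
  becomes a fact about finite families of reals.\<close>

lemma centering_matrix_mult_nth:
  fixes X :: "real ^ 'd::finite ^ 'm::finite"
  shows "(centering_matrix ** X) $ i $ j = X $ i $ j - (\<Sum>k\<in>UNIV. X $ k $ j) / real CARD('m)"
proof -
  have "(centering_matrix ** X) $ i $ j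
      = (\<Sum>k\<in>UNIV. (if i = k then X $ k $ j else 0) - X $ k $ j / real CARD('m))"
    unfolding centering_matrix_def matrix_matrix_mult_def
    by (auto simp: mat_def left_diff_distrib intro!: sum.cong)
  then show ?thesis
    by (simp add: sum_subtractf sum_divide_distrib)
qed

text \<open>The variance identity: with \<open>n\<close> terms and mean \<open>m\<close>, centering
  lowers the sum of squares by exactly \<open>n * m\<^sup>2\<close>.\<close>

lemma sum_square_diff_mean_le:
  fixes x :: "'a \<Rightarrow> real"
  assumes "finite I"
  shows "(\<Sum>i\<in>I. (x i - sum x I / card I)\<^sup>2) \<le> (\<Sum>i\<in>I. (x i)\<^sup>2)"
proof (cases "I = {}")
  case False
  define n where "n = real (card I)"
  define m where "m = sum x I / n"
  have "n > 0"
    using False assms by (simp add: n_def card_gt_0_iff)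
  then have sum_x: "sum x I = n * m"
    by (simp add: m_def)
  have "(\<Sum>i\<in>I. (x i - m)\<^sup>2) = (\<Sum>i\<in>I. (x i)\<^sup>2 - 2 * m * x i + m\<^sup>2)"
    by (simp add: power2_diff algebra_simps)
  also have "\<dots> = (\<Sum>i\<in>I. (x i)\<^sup>2) - 2 * m * sum x I + n * m\<^sup>2"
    by (simp add: sum.distrib sum_subtractf sum_distrib_left n_def)
  also have "\<dots> = (\<Sum>i\<in>I. (x i)\<^sup>2) - n * m\<^sup>2"
    by (simp add: sum_x power2_eq_square)
  also have "\<dots> \<le> (\<Sum>i\<in>I. (x i)\<^sup>2)"
    using \<open>n > 0\<close> by simp
  finally show ?thesis
    by (simp add: m_def n_def)
qed simp

lemma norm_centering_matrix_mult_le: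
  fixes X :: "real ^ 'd::finite ^ 'm::finite"
  shows "norm (centering_matrix ** X) \<le> norm X"
proof -
  have "(norm (centering_matrix ** X))\<^sup>2
      = (\<Sum>j\<in>UNIV. \<Sum>i\<in>UNIV. (X $ i $ j - (\<Sum>k\<in>UNIV. X $ k $ j) / real CARD('m))\<^sup>2)"
    unfolding power2_norm_eq_inner
    \<comment> \<open>Columns become the outer index, since each mean runs down one column.\<close>
    by (subst sum.swap) (simp add: inner_vec_def centering_matrix_mult_nth power2_eq_square)
  also have "\<dots> \<le> (\<Sum>j\<in>UNIV. \<Sum>i\<in>UNIV. (X $ i $ j)\<^sup>2)"
    by (intro sum_mono sum_square_diff_mean_le) simp
  also have "\<dots> = (norm X)\<^sup>2"
    unfolding power2_norm_eq_inner
    by (subst sum.swap) (simp add: inner_vec_def power2_eq_square)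
  finally show ?thesis
    by simp
qed

lemma cohort_norm_centering_le: "cohort_norm (centering X) \<le> cohort_norm X"
proof -
  have "norm (centering X) \<le> norm X"
    \<comment> \<open>The two applications descend through inputs and heads to single
      matrices.\<close>
    by (rule norm_le_componentwise_cart, rule norm_le_componentwise_cart)
      (simp add: centering_def norm_centering_matrix_mult_le)
  then show ?thesis
    by (simp add: cohort_norm_eq divide_right_mono)
qed

lemma centering_add: "centering (X + Y) = centering X + centering Y"
  by (simp add: centering_def vec_eq_iff matrix_add_ldistrib)

theorem theorem1:
  fixes Z \<Delta>Z E T :: "('s::finite, 'h::finite, 'm::finite, 'd::finite) cohort"
    and A :: "real ^ 'm ^ 'm ^ 'h ^ 's"
    and W :: "real ^ 'd ^ 'd ^ 'h"
    and q s_Z e \<alpha> \<theta> \<gamma>_star \<gamma> L_no L_van L_SRPA :: real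
  assumes "\<And>s r. row_stochastic (A $ s $ r)"
    and "\<Delta>Z = attention_update A W Z"
    and "0 \<le> q" and "q < 1"
    and "s_Z = cohort_norm (centering Z)" and "s_Z > 0"
    and "cohort_norm (centering \<Delta>Z) \<le> q * s_Z"
    and "T = Z + E"
    and "e = cohort_norm E" and "0 < e" and "e < (1 / 2) * (1 - q) * s_Z"
    and "\<Delta>Z \<noteq> 0"
    and "0 < \<alpha>" and "\<alpha> \<le> 1"
    and "\<bar>cohort_inner E \<Delta>Z\<bar> \<ge> \<alpha> * e * cohort_norm \<Delta>Z"
    and "\<gamma>_star = cohort_inner E \<Delta>Z / (cohort_norm \<Delta>Z)\<^sup>2"
    and "0 < \<theta>" and "\<theta> \<le> 1"
    and "\<gamma> = \<theta> * \<gamma>_star"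
    and "L_no = (cohort_norm (Z - T))\<^sup>2"
    and "L_van = (cohort_norm (\<Delta>Z - T))\<^sup>2"
    and "L_SRPA = (cohort_norm (Z + \<gamma> *\<^sub>R \<Delta>Z - T))\<^sup>2"
  shows "(L_SRPA \<le> (1 - \<theta> * (2 - \<theta>) * \<alpha>\<^sup>2) * e\<^sup>2 \<and>
          (1 - \<theta> * (2 - \<theta>) * \<alpha>\<^sup>2) * e\<^sup>2 < L_no \<and>
          L_no = e\<^sup>2 \<and>
          e\<^sup>2 < L_van) \<and>
         cohort_norm (\<gamma> *\<^sub>R \<Delta>Z) \<le> \<theta> * e \<and>
         (cohort_norm (centering (Z + \<gamma> *\<^sub>R \<Delta>Z)) \<ge> s_Z - \<theta> * e \<and>
          s_Z - \<theta> * e > q * s_Z \<and>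
          q * s_Z \<ge> cohort_norm (centering \<Delta>Z))"
proof -
  let ?D = "cohort_norm \<Delta>Z"
  let ?c = "cohort_inner E \<Delta>Z"
  have D_pos: "0 < ?D"
    using assms(12) by (rule cohort_norm_pos)
  have gamma: "\<gamma> = \<theta> * ?c / ?D\<^sup>2"
    using assms(16,19) by simp

  have L_no: "L_no = e\<^sup>2"
    by (simp add: assms(8,9,20) cohort_norm_minus)

  have "L_SRPA = e\<^sup>2 - 2 * \<gamma> * ?c + \<gamma>\<^sup>2 * ?D\<^sup>2"
    \<comment> \<open>Since \<open>T = Z + E\<close>, the residual
      \<open>Z + \<gamma> *\<^sub>R \<Delta>Z - T\<close> is
      \<open>\<gamma> *\<^sub>R \<Delta>Z - E\<close>.\<close>
    using cohort_norm_square_diff[of \<gamma> \<Delta>Z E] by (simp add: assms(8,9,22))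
  also have "\<dots> = e\<^sup>2 - \<theta> * (2 - \<theta>) * (?c\<^sup>2 / ?D\<^sup>2)"
    using D_pos by (simp add: gamma power2_eq_square field_simps)
  finally have L_SRPA: "L_SRPA = e\<^sup>2 - \<theta> * (2 - \<theta>) * (?c\<^sup>2 / ?D\<^sup>2)" .
  \<comment> \<open>The alignment hypothesis, squared, bounds the guaranteed decrease from
    below.\<close>
  have "(\<alpha> * e * ?D)\<^sup>2 \<le> \<bar>?c\<bar>\<^sup>2"
    using assms(10,13,15) D_pos by (intro power_mono) auto
  then have "\<alpha>\<^sup>2 * e\<^sup>2 \<le> ?c\<^sup>2 / ?D\<^sup>2"
    using D_pos by (simp add: power_mult_distrib pos_le_divide_eq)
  then have "\<theta> * (2 - \<theta>) * (\<alpha>\<^sup>2 * e\<^sup>2) \<le> \<theta> * (2 - \<theta>) * (?c\<^sup>2 / ?D\<^sup>2)"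
    using assms(17,18) by (intro mult_left_mono) auto
  then have SRPA_le: "L_SRPA \<le> (1 - \<theta> * (2 - \<theta>) * \<alpha>\<^sup>2) * e\<^sup>2"
    by (simp add: L_SRPA algebra_simps)

  have "0 < \<theta> * (2 - \<theta>) * \<alpha>\<^sup>2 * e\<^sup>2"
    using assms(10,13,17,18) by simp
  then have SRPA_less: "(1 - \<theta> * (2 - \<theta>) * \<alpha>\<^sup>2) * e\<^sup>2 < L_no"
    by (simp add: L_no algebra_simps)

  have "cohort_norm (\<gamma> *\<^sub>R \<Delta>Z) = \<theta> * (\<bar>?c\<bar> / ?D)"
    using D_pos assms(17)
    by (simp add: cohort_norm_scaleR gamma abs_mult power2_eq_square)
  also have "\<dots> \<le> \<theta> * e"
    using cohort_Cauchy_Schwarz[of E \<Delta>Z] D_pos assms(9,17)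
    by (intro mult_left_mono) (simp_all add: pos_divide_le_eq)
  finally have step: "cohort_norm (\<gamma> *\<^sub>R \<Delta>Z) \<le> \<theta> * e" .

  \<comment> \<open>Keeping \<open>\<Delta>Z\<close> as a separate summand lets its centered part be
    bounded by \<open>q * s_Z\<close>; the other two summands only need nonexpansiveness.\<close>
  have "centering Z = centering \<Delta>Z + (centering (- (\<Delta>Z - T)) + centering (- E))"
    by (simp add: assms(8) flip: centering_add)
  then have "s_Z \<le> cohort_norm (centering \<Delta>Z)
      + (cohort_norm (centering (- (\<Delta>Z - T))) + cohort_norm (centering (- E)))"
    unfolding assms(5) by (smt (verit) cohort_norm_triangle)
  also have "\<dots> \<le> q * s_Z + (cohort_norm (\<Delta>Z - T) + e)"
    using assms(7,9) cohort_norm_centering_le[of "- (\<Delta>Z - T)"] cohort_norm_centering_le[of "- E"]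
    unfolding cohort_norm_minus by linarith
  \<comment> \<open>One \<open>e\<close> comes from the term \<open>- E\<close>, the other is the
    bound sought; the factor \<open>1 / 2\<close> in the hypothesis on \<open>e\<close> pays for
    both.\<close>
  finally have "e < cohort_norm (\<Delta>Z - T)"
    using assms(11) by (simp add: algebra_simps)
  then have van: "e\<^sup>2 < L_van"
    using assms(10,21) by (simp add: power_strict_mono)

  \<comment> \<open>Undoing the step yields the reverse triangle inequality.\<close>
  have "centering Z = centering (Z + \<gamma> *\<^sub>R \<Delta>Z) + centering (- (\<gamma> *\<^sub>R \<Delta>Z))"
    by (simp flip: centering_add)
  then have "s_Z \<le> cohort_norm (centering (Z + \<gamma> *\<^sub>R \<Delta>Z)) + cohort_norm (centering (- (\<gamma> *\<^sub>R \<Delta>Z)))"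
    unfolding assms(5) by (metis cohort_norm_triangle)
  moreover have "cohort_norm (centering (- (\<gamma> *\<^sub>R \<Delta>Z))) \<le> \<theta> * e"
    using cohort_norm_centering_le[of "- (\<gamma> *\<^sub>R \<Delta>Z)"] step by (simp add: cohort_norm_minus)
  ultimately have center: "s_Z - \<theta> * e \<le> cohort_norm (centering (Z + \<gamma> *\<^sub>R \<Delta>Z))"
    by linarith

  have "\<theta> * e \<le> e"
    using assms(10,18) by simp
  moreover have "e < (1 - q) * s_Z"
    using assms(10,11) by simp
  ultimately have "q * s_Z < s_Z - \<theta> * e"
    by (simp add: algebra_simps)
  then show ?thesis
    using L_no SRPA_le SRPA_less step van center assms(7) by blast
qed

end
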